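(* Let $V$ be an $\mathbb{R}$-vector space of finite dimension $n$, let $K\subseteq\mathbb{R}$ be a subfield, let $W$ be a $K$-structure on $V$, and let $\Sigma$ be a $W$-semifan in $V$. Then the topological frontier of the support of $\Sigma$ is $$\mathrm{fr}(|\Sigma|)=\Bigl(\bigcup\mathfrak{D}(\Sigma)\Bigr)\cup\Bigl(\bigcup\mathfrak{F}(\Sigma)\Bigr).$$
   Context: $V$ carries its canonical topology and $\mathrm{fr}$ denotes the topological frontier in $V$. A $K$-structure on $V$ is a sub-$K$-vector space $W\subseteq V$ such that the canonical map $\mathbb{R}\otimes_K W\to V$ is an isomorphism. A subspace of $V$ is $W$-rational if it has a basis contained in $W$. A $W$-polycone is the intersection of finitely many closed linear halfspaces bounded by $W$-rational linear hyperplanes; its dimension is that of its linear span. A face of a $W$-polycone $\sigma$ is a set $\sigma\cap\ker(u)$ with $u\in V^*$, $u(\sigma)\subseteq\mathbb{R}_{\geq 0}$; one writes $\tau\preccurlyeq\sigma$ if $\tau$ is a face of $\sigma$. A $W$-semifan is a finite set $\Sigma$ of $W$-polycones, closed under taking faces, such that $\sigma\cap\tau$ is a face of $\sigma$ for all $\sigma,\tau\in\Sigma$. $|\Sigma|=\bigcup\Sigma$; $\Sigma_k$ is the set of $k$-dimensional elements of $\Sigma$; $\Sigma_{\max}$ is the set of maximal elements of $\Sigma$ with respect to $\preccurlyeq$. One sets $\mathfrak{D}(\Sigma)=\Sigma_{\max}\setminus\Sigma_n$ and $\mathfrak{F}(\Sigma)=\{\sigma\in\Sigma_{n-1}\mid\text{there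 is exactly one }\tau\in\Sigma_n\text{ with }\sigma\preccurlyeq\tau\}$. *)

theory Defs
  imports
    "HOL-Analysis.Analysis"
    "HOL-Algebra.Free_Abelian_Groups"
    "HOL-Algebra.Algebraic_Closure_Type"
begin

section \<open>The canonical topology of a finite-dimensional real vector space\<close>

text \<open>The ambient space \<open>V\<close> is a type of class \<^class>\<open>real_vector\<close>, assumed to be spanned by a
  finite set where needed. No norm is fixed, and dimension \<open>0\<close> is allowed (which
  \<^class>\<open>euclidean_space\<close> excludes).\<close>

definition coordinate_topology :: "'a::real_vector set \<Rightarrow> 'a topology" where
  "coordinate_topology B =
     pullback_topology UNIV (\<lambda>v. restrict (representation B v) B) (powertop_real B)"

definition canonical_topology :: "'a::real_vector topology" where
  "canonical_topology = coordinate_topology (SOME B. independent B \<and> span B = UNIV)"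

lemma topspace_coordinate_topology [simp]: "topspace (coordinate_topology B) = UNIV"
  by (auto simp: coordinate_topology_def topspace_pullback_topology)

lemma linear_representation_real:
  assumes "independent B" "span B = UNIV"
  shows "linear (\<lambda>v. representation B v b)"
  by (rule linearI) (simp_all add: assms real_vector.representation_add real_vector.representation_scale)

lemma continuous_map_coordinate:
  assumes "b \<in> B"
  shows "continuous_map (coordinate_topology B) euclideanreal (\<lambda>v. representation B v b)"
proof -
  have "continuous_map (coordinate_topology B) euclideanreal
          ((\<lambda>f. f b) \<circ> (\<lambda>v. restrict (representation B v) B))"
    unfolding coordinate_topology_def
    by (intro continuous_map_pullback continuous_map_product_projection assms)
  then show ?thesis using assms by (simp add: o_def)
qed

lemma linear_eq_sum_representation:
  fixes u :: "'a::real_vector \<Rightarrow> real"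
  assumes "finite B" "independent B" "span B = UNIV" "linear u"
  shows "u v = (\<Sum>b\<in>B. representation B v b * u b)"
proof -
  have "v = (\<Sum>b\<in>B. representation B v b *\<^sub>R b)"
    using real_vector.sum_representation_eq[OF assms(2) _ assms(1) order_refl, of v] assms(3)
    by simp
  then have "u v = u (\<Sum>b\<in>B. representation B v b *\<^sub>R b)" by simp
  also have "\<dots> = (\<Sum>b\<in>B. representation B v b * u b)"
    using assms(4) by (simp add: linear_sum linear_cmul)
  finally show ?thesis .
qed

lemma continuous_map_linear_coordinate_topology:
  fixes u :: "'a::real_vector \<Rightarrow> real"
  assumes "finite B" "independent B" "span B = UNIV" "linear u"
  shows "continuous_map (coordinate_topology B) euclideanreal u"
proof -
  have "u = (\<lambda>v. \<Sum>b\<in>B. representation B v b * u b)"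
    using linear_eq_sum_representation[OF assms] by blast
  moreover have "continuous_map (coordinate_topology B) euclideanreal
      (\<lambda>v. \<Sum>b\<in>B. representation B v b * u b)"
    by (intro continuous_map_sum continuous_map_real_mult continuous_map_coordinate
          continuous_map_const[THEN iffD2]) (auto simp: assms)
  ultimately show ?thesis by simp
qed

lemma continuous_map_into_coordinate_topology:
  assumes "\<And>b. b \<in> B \<Longrightarrow> continuous_map T euclideanreal (\<lambda>x. representation B (g x) b)"
  shows "continuous_map T (coordinate_topology B) g"
  unfolding coordinate_topology_def
  by (intro continuous_map_pullback')
     (use assms in \<open>auto simp: o_def continuous_map_componentwise\<close>)

lemma coordinate_topology_independent_of_basis:
  fixes B C :: "'a::real_vector set"
  assumes "finite B" "independent B" "span B = UNIV"
    and "finite C" "independent C" "span C = UNIV"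
  shows "coordinate_topology B = coordinate_topology C"
proof -
  have *: "continuous_map (coordinate_topology A) (coordinate_topology D) (\<lambda>x. x)"
    if "finite A" "independent A" "span A = UNIV" "independent D" "span D = UNIV"
    for A D :: "'a set"
    using that
    by (intro continuous_map_into_coordinate_topology continuous_map_linear_coordinate_topology
          linear_representation_real) auto
  have "continuous_map (coordinate_topology B) (coordinate_topology C) (\<lambda>x. x)"
    and "continuous_map (coordinate_topology C) (coordinate_topology B) (\<lambda>x. x)"
    using * assms by blast+
  then show ?thesis
    by (auto simp: topology_eq continuous_map_def)
qed

lemma canonical_topology_eq:
  fixes B :: "'a::real_vector set"
  assumes "finite B" "independent B" "span B = UNIV"
  shows "canonical_topology = coordinate_topology B"
proof -
  let ?C = "SOME B :: 'a set. independent B \<and> span B = UNIV"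
  have C: "independent ?C \<and> span ?C = UNIV"
    using assms by (intro someI[of "\<lambda>B. independent B \<and> span B = UNIV" B]) simp
  have "finite ?C"
    using real_vector.independent_span_bound[of B ?C] assms C by auto
  then show ?thesis
    unfolding canonical_topology_def
    using C assms by (intro coordinate_topology_independent_of_basis) auto
qed

lemma canonical_topology_euclidean_space:
  "(canonical_topology :: 'a::euclidean_space topology) = euclidean"
proof -
  have eq: "(canonical_topology :: 'a topology) = coordinate_topology Basis"
    by (intro canonical_topology_eq) (auto simp: independent_Basis)
  have rep: "continuous_on UNIV (\<lambda>x::'a. representation Basis x b)" for b :: 'a
    by (intro linear_continuous_on linear_conv_bounded_linear[THEN iffD1]
          linear_representation_real) (auto simp: independent_Basis)
  have "continuous_map euclidean (coordinate_topology Basis) (\<lambda>x::'a. x)"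
    by (intro continuous_map_into_coordinate_topology) (simp add: rep)
  moreover have "continuous_map (coordinate_topology Basis) euclidean (\<lambda>x::'a. x)"
  proof -
    have "continuous_map (coordinate_topology Basis) euclidean
            (\<lambda>x::'a. \<Sum>b\<in>Basis. (x \<bullet> b) *\<^sub>R b)"
    proof (intro continuous_map_sum)
      fix b :: 'a assume "b \<in> Basis"
      have "continuous_map (coordinate_topology Basis) euclideanreal (\<lambda>x::'a. x \<bullet> b)"
        by (intro continuous_map_linear_coordinate_topology)
           (auto simp: independent_Basis intro: bounded_linear.linear bounded_linear_inner_left)
      moreover have "continuous_map euclideanreal euclidean (\<lambda>r. r *\<^sub>R b)"
        by (simp add: continuous_on_scaleR)
      ultimately show "continuous_map (coordinate_topology Basis) euclidean (\<lambda>x::'a. (x \<bullet> b) *\<^sub>R b)"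
        using continuous_map_compose[of _ _ "\<lambda>x::'a. x \<bullet> b" _ "\<lambda>r. r *\<^sub>R b"]
        by (simp add: o_def)
    qed auto
    then show ?thesis by (simp add: euclidean_representation)
  qed
  ultimately show ?thesis
    unfolding eq by (auto simp: topology_eq continuous_map_def)
qed


section \<open>\<open>K\<close>-structures\<close>

definition sub_K_space :: "real set \<Rightarrow> 'a::real_vector set \<Rightarrow> bool" where
  "sub_K_space K W \<longleftrightarrow>
     0 \<in> W \<and> (\<forall>x\<in>W. \<forall>y\<in>W. x + y \<in> W) \<and> (\<forall>k\<in>K. \<forall>x\<in>W. k *\<^sub>R x \<in> W)"

text \<open>\<open>\<real> \<otimes>\<^sub>K W\<close> is the free abelian group on \<open>\<real> \<times> W\<close> modulo the usual relations; the pair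
  \<open>(r, w)\<close> stands for \<open>r \<otimes> w\<close>.\<close>

definition tensor_relators :: "real set \<Rightarrow> 'a::real_vector set \<Rightarrow> ((real \<times> 'a) \<Rightarrow>\<^sub>0 int) set" where
  "tensor_relators K W =
     {frag_of (r + s, w) - frag_of (r, w) - frag_of (s, w) | r s w. w \<in> W} \<union>
     {frag_of (r, v + w) - frag_of (r, v) - frag_of (r, w) | r v w. v \<in> W \<and> w \<in> W} \<union>
     {frag_of (r * k, w) - frag_of (r, k *\<^sub>R w) | r k w. k \<in> K \<and> w \<in> W}"

definition tensor_kernel :: "real set \<Rightarrow> 'a::real_vector set \<Rightarrow> ((real \<times> 'a) \<Rightarrow>\<^sub>0 int) set" where
  "tensor_kernel K W = generate (free_Abelian_group (UNIV \<times> W)) (tensor_relators K W)"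

definition real_tensor :: "real set \<Rightarrow> 'a::real_vector set \<Rightarrow> ((real \<times> 'a) \<Rightarrow>\<^sub>0 int) set monoid" where
  "real_tensor K W = free_Abelian_group (UNIV \<times> W) Mod tensor_kernel K W"

definition formal_eval :: "((real \<times> 'a) \<Rightarrow>\<^sub>0 int) \<Rightarrow> 'a::real_vector" where
  "formal_eval c = (\<Sum>(r, w)\<in>Poly_Mapping.keys c. of_int (Poly_Mapping.lookup c (r, w)) *\<^sub>R (r *\<^sub>R w))"

text \<open>The map \<open>\<real> \<otimes>\<^sub>K W \<rightarrow> V\<close>, \<open>r \<otimes> w \<mapsto> r w\<close>, induced by \<^const>\<open>formal_eval\<close> on cosets; see
  \<open>canonical_map_tensor\<close> below.\<close>

definition canonical_map :: "((real \<times> 'a) \<Rightarrow>\<^sub>0 int) set \<Rightarrow> 'a::real_vector" where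
  "canonical_map C = the_elem (formal_eval ` C)"

text \<open>The canonical map is always \<open>\<real>\<close>-linear, so it is an isomorphism iff it is bijective.\<close>

definition K_structure :: "real set \<Rightarrow> 'a::real_vector set \<Rightarrow> bool" where
  "K_structure K W \<longleftrightarrow>
     sub_K_space K W \<and> bij_betw canonical_map (carrier (real_tensor K W)) UNIV"

lemma formal_eval_superset:
  assumes "finite S" "Poly_Mapping.keys c \<subseteq> S"
  shows "formal_eval c =
    (\<Sum>(r, w)\<in>S. of_int (Poly_Mapping.lookup c (r, w)) *\<^sub>R (r *\<^sub>R w))"
  unfolding formal_eval_def using assms
  by (intro sum.mono_neutral_left) (auto simp: in_keys_iff)

lemma formal_eval_add: "formal_eval (c + d) = formal_eval c + formal_eval d"
proof -
  let ?S = "Poly_Mapping.keys c \<union> Poly_Mapping.keys d"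
  have "Poly_Mapping.keys (c + d) \<subseteq> ?S" by (rule keys_add)
  then show ?thesis
    by (subst (1 2 3) formal_eval_superset[of ?S])
       (auto simp: lookup_add scaleR_left_distrib distrib_right sum.distrib case_prod_unfold)
qed

lemma formal_eval_uminus: "formal_eval (- c) = - formal_eval c"
  unfolding formal_eval_def by (auto simp: sum_negf case_prod_unfold)

lemma formal_eval_diff: "formal_eval (c - d) = formal_eval c - formal_eval d"
  using formal_eval_add[of c "- d"] by (simp add: formal_eval_uminus)

lemma formal_eval_frag_of [simp]: "formal_eval (frag_of (r, w)) = r *\<^sub>R w"
  unfolding formal_eval_def by simp

lemma formal_eval_tensor_kernel:
  assumes "sub_K_space K W" "c \<in> tensor_kernel K W"
  shows "formal_eval c = 0"
proof -
  have rel: "formal_eval h = 0" "h \<in> carrier (free_Abelian_group (UNIV \<times> W))"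
    if "h \<in> tensor_relators K W" for h
  proof -
    show "formal_eval h = 0"
      using that unfolding tensor_relators_def
      by (auto simp: formal_eval_diff scaleR_left_distrib scaleR_right_distrib)
    show "h \<in> carrier (free_Abelian_group (UNIV \<times> W))"
      using that assms(1) unfolding tensor_relators_def sub_K_space_def carrier_free_Abelian_group_iff
      by (elim UnE CollectE exE conjE; hypsubst)
         (rule order_trans[OF keys_diff] Un_least | simp)+
  qed
  show ?thesis
    using assms(2) unfolding tensor_kernel_def
  proof induction
    case one
    then show ?case by (simp add: formal_eval_def)
  next
    case (incl h)
    then show ?case by (rule rel)
  next
    case (inv h)
    then show ?case using rel(2)[OF inv] by (simp add: rel inv_free_Abelian_group formal_eval_uminus)
  next
    case (eng h1 h2)
    then show ?case by (simp add: formal_eval_add)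
  qed
qed

lemma canonical_map_tensor:
  assumes "sub_K_space K W" "w \<in> W"
  shows "canonical_map (tensor_kernel K W #>\<^bsub>free_Abelian_group (UNIV \<times> W)\<^esub> frag_of (r, w)) =
    r *\<^sub>R w"
proof -
  have "0 \<in> tensor_kernel K W"
    unfolding tensor_kernel_def using generate.one[of "free_Abelian_group (UNIV \<times> W)"] by simp
  then have "tensor_kernel K W \<noteq> {}" by blast
  moreover have "tensor_kernel K W #>\<^bsub>free_Abelian_group (UNIV \<times> W)\<^esub> frag_of (r, w) =
      (\<lambda>c. c + frag_of (r, w)) ` tensor_kernel K W"
    by (auto simp: r_coset_def)
  moreover have "formal_eval (c + frag_of (r, w)) = r *\<^sub>R w" if "c \<in> tensor_kernel K W" for c
    using formal_eval_tensor_kernel[OF assms(1) that] by (simp add: formal_eval_add)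
  ultimately have "formal_eval `
      (tensor_kernel K W #>\<^bsub>free_Abelian_group (UNIV \<times> W)\<^esub> frag_of (r, w)) = {r *\<^sub>R w}"
    by (simp add: image_image image_constant_conv cong: image_cong)
  then show ?thesis by (simp add: canonical_map_def)
qed


section \<open>Polycones and semifans\<close>

definition rational_subspace :: "'a::real_vector set \<Rightarrow> 'a set \<Rightarrow> bool" where
  "rational_subspace W U \<longleftrightarrow> (\<exists>B\<subseteq>W. independent B \<and> span B = U)"

definition rational_halfspace :: "'a::real_vector set \<Rightarrow> 'a set \<Rightarrow> bool" where
  "rational_halfspace W H \<longleftrightarrow>
     (\<exists>u :: 'a \<Rightarrow> real. linear u \<and> (\<exists>x. u x \<noteq> 0) \<and> rational_subspace W {x. u x = 0} \<and>
        H = {x. u x \<ge> 0})"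

text \<open>The empty family is allowed, so \<^const>\<open>UNIV\<close> is a polycone.\<close>

definition polycone :: "'a::real_vector set \<Rightarrow> 'a set \<Rightarrow> bool" where
  "polycone W \<sigma> \<longleftrightarrow> (\<exists>\<H>. finite \<H> \<and> (\<forall>H\<in>\<H>. rational_halfspace W H) \<and> \<sigma> = \<Inter>\<H>)"

definition cone_dim :: "'a::real_vector set \<Rightarrow> nat" where
  "cone_dim \<sigma> = dim (span \<sigma>)"

definition cone_face :: "'a::real_vector set \<Rightarrow> 'a set \<Rightarrow> bool" (infix \<open>\<preceq>\<^sub>f\<close> 50) where
  "\<tau> \<preceq>\<^sub>f \<sigma> \<longleftrightarrow>
     (\<exists>u :: 'a \<Rightarrow> real. linear u \<and> (\<forall>x\<in>\<sigma>. u x \<ge> 0) \<and> \<tau> = \<sigma> \<inter> {x. u x = 0})"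

definition semifan :: "'a::real_vector set \<Rightarrow> 'a set set \<Rightarrow> bool" where
  "semifan W \<Sigma> \<longleftrightarrow> finite \<Sigma> \<and> (\<forall>\<sigma>\<in>\<Sigma>. polycone W \<sigma>) \<and>
     (\<forall>\<sigma>\<in>\<Sigma>. \<forall>\<tau>. \<tau> \<preceq>\<^sub>f \<sigma> \<longrightarrow> \<tau> \<in> \<Sigma>) \<and> (\<forall>\<sigma>\<in>\<Sigma>. \<forall>\<tau>\<in>\<Sigma>. \<sigma> \<inter> \<tau> \<preceq>\<^sub>f \<sigma>)"

text \<open>The index is an integer because \<open>\<Sigma>\<^sub>n\<^sub>-\<^sub>1\<close> must be empty when \<open>n = 0\<close>.\<close>

definition cones_of_dim :: "'a::real_vector set set \<Rightarrow> int \<Rightarrow> 'a set set" where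
  "cones_of_dim \<Sigma> k = {\<sigma>\<in>\<Sigma>. int (cone_dim \<sigma>) = k}"

definition max_cones :: "'a::real_vector set set \<Rightarrow> 'a set set" where
  "max_cones \<Sigma> = {\<sigma>\<in>\<Sigma>. \<forall>\<tau>\<in>\<Sigma>. \<sigma> \<preceq>\<^sub>f \<tau> \<longrightarrow> \<tau> = \<sigma>}"

abbreviation ambient_dim :: "'a::real_vector itself \<Rightarrow> int" where
  "ambient_dim _ \<equiv> int (dim (UNIV :: 'a set))"

definition deficient_cones :: "'a::real_vector set set \<Rightarrow> 'a set set" (\<open>\<DD>\<close>) where
  "\<DD> \<Sigma> = max_cones \<Sigma> - cones_of_dim \<Sigma> (ambient_dim TYPE('a))"

definition free_facets :: "'a::real_vector set set \<Rightarrow> 'a set set" (\<open>\<FF>\<close>) where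
  "\<FF> \<Sigma> = {\<sigma> \<in> cones_of_dim \<Sigma> (ambient_dim TYPE('a) - 1).
            \<exists>!\<tau>. \<tau> \<in> cones_of_dim \<Sigma> (ambient_dim TYPE('a)) \<and> \<sigma> \<preceq>\<^sub>f \<tau>}"

end

theory Submission
  imports Defs
begin

text \<open>
  The support is closed, so its frontier is the set of its non-interior points.

  For a cone \<open>\<sigma>\<close> of either family, a point of \<open>\<sigma>\<close> that avoids the proper faces lies only in cones having
  \<open>\<sigma>\<close> as a face. A nonzero functional that vanishes on \<open>\<sigma>\<close> and is nonnegative on all those cones then
  bounds the support near the point. Shifting a point of \<open>\<sigma>\<close> slightly in a generic direction of \<open>\<sigma>\<close> reduces
  the general case to this one, the interior being open.

  Conversely let \<open>x\<close> in the support lie in neither union. It lies in some full-dimensional cone. If \<open>y\<close> near \<open>x\<close>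
  were outside the support, join it to a generic point \<open>z\<close> of that cone near \<open>x\<close>, so that the segment
  misses all cones of codimension at least two. The last point \<open>p\<close> of the segment in a full-dimensional
  cone lies in a facet \<open>\<sigma>\<close>, which contains \<open>x\<close> and hence is not free. Near \<open>p\<close> both full-dimensional cones at
  \<open>\<sigma>\<close> are halfspaces, on the same side of \<open>span \<sigma>\<close> because the segment leaves both of them at \<open>p\<close>. So they
  overlap outside \<open>\<sigma>\<close>, although their intersection is a proper common face.
\<close>

section \<open>Linear functionals and dimension\<close>

lemma polycone_functionals:
  assumes "polycone W \<sigma>"
  shows "\<exists>U :: ('a::real_vector \<Rightarrow> real) set. finite U \<and> (\<forall>u\<in>U. linear u) \<and>
    \<sigma> = {x. \<forall>u\<in>U. u x \<ge> 0}"
proof -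
  obtain \<H> where fin: "finite \<H>" and rat: "\<forall>H\<in>\<H>. rational_halfspace W H" and eq: "\<sigma> = \<Inter>\<H>"
    using assms unfolding polycone_def by blast
  have "\<forall>H\<in>\<H>. \<exists>u :: 'a \<Rightarrow> real. linear u \<and> H = {x. u x \<ge> 0}"
    using rat unfolding rational_halfspace_def by blast
  then obtain f :: "'a set \<Rightarrow> 'a \<Rightarrow> real"
    where f: "\<And>H. H \<in> \<H> \<Longrightarrow> linear (f H) \<and> H = {x. f H x \<ge> 0}"
    by metis
  have "\<sigma> = {x. \<forall>u\<in>f ` \<H>. u x \<ge> 0}"
    using f eq by blast
  moreover have "\<forall>u\<in>f ` \<H>. linear u"
    using f by blast
  ultimately show ?thesis
    using fin by (intro exI[of _ "f ` \<H>"] conjI) simp_all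
qed

text \<open>Extend a basis of \<open>span S\<close> by a vector outside the span; some functional is
  1 at that vector and 0 on the basis.\<close>

lemma exists_functional_vanishing_on:
  fixes S :: "'a::real_vector set"
  assumes "span S \<noteq> UNIV"
  obtains w :: "'a \<Rightarrow> real" and v
  where "linear w" "w v = 1" "\<And>x. x \<in> span S \<Longrightarrow> w x = 0"
proof -
  obtain B where B: "B \<subseteq> S" "independent B" "span B = span S"
    using real_vector.maximal_independent_subset[of S]
    by (metis real_vector.span_mono real_vector.span_span subset_antisym)
  obtain v where v: "v \<notin> span B"
    using assms B by blast
  then have ind: "independent (insert v B)"
    using B(2) by (simp add: real_vector.independent_insertI)
  obtain w :: "'a \<Rightarrow> real" where w: "linear w" "\<forall>x\<in>insert v B. w x = (if x = v then 1 else 0)"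
    using linear_independent_extend[OF ind, of "\<lambda>x. if x = v then 1 else 0"] by blast
  have "v \<notin> B" using v real_vector.span_base by blast
  then have "w x = 0" if "x \<in> B" for x
    using w(2) that by auto
  then have "w x = 0" if "x \<in> span S" for x
    using linear_eq_0_on_span[OF w(1), of B x] B(3) that by blast
  then show thesis
    using that[of w v] w by auto
qed

lemma finite_basis_exists:
  fixes B :: "'a::real_vector set"
  assumes "finite B" "span B = UNIV"
  obtains C :: "'a set" where "finite C" "independent C" "span C = UNIV"
proof -
  obtain C where "C \<subseteq> B" "independent C" "span C = UNIV"
    using real_vector.maximal_independent_subset[of B] assms(2)
    by (metis real_vector.span_mono real_vector.span_span top.extremum_uniqueI)
  then show thesis
    using that assms(1) finite_subset by blast
qed

text \<open>A basis extracted from the spanning set allows an interpretation of the locale of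
  finite-dimensional vector spaces, from which the three facts are read off.\<close>

lemma finite_dim_real:
  fixes B :: "'a::real_vector set"
  assumes "finite B" "span B = UNIV"
  shows dim_eq_imp_span_eq: "\<And>S T :: 'a set. S \<subseteq> T \<Longrightarrow> dim T \<le> dim S \<Longrightarrow> span S = span T"
    and dim_mono_real: "\<And>S T :: 'a set. S \<subseteq> T \<Longrightarrow> dim S \<le> dim T"
    and dim_insert_real: "\<And>S (y::'a). dim (insert y S) = (if y \<in> span S then dim S else dim S + 1)"
proof -
  obtain C :: "'a set" where C: "finite C" "independent C" "span C = UNIV"
    using finite_basis_exists[OF assms] .
  then interpret fd: finite_dimensional_vector_space "scaleR :: real \<Rightarrow> 'a \<Rightarrow> 'a" C
    by unfold_locales (auto simp: dependent_raw_def span_raw_def)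
  show "span S = span T" if "S \<subseteq> T" "dim T \<le> dim S" for S T :: "'a set"
    using fd.dim_eq_span[of S T] that by (simp add: dim_raw_def span_raw_def)
  show "dim S \<le> dim T" if "S \<subseteq> T" for S T :: "'a set"
    using fd.dim_subset[of S T] that by (simp add: dim_raw_def)
  show "dim (insert y S) = (if y \<in> span S then dim S else dim S + 1)" for S and y :: 'a
    using fd.dim_insert[of y S] by (simp add: dim_raw_def span_raw_def)
qed


section \<open>Rays and open sets in the canonical topology\<close>

lemma topspace_canonical_topology [simp]: "topspace canonical_topology = UNIV"
  by (simp add: canonical_topology_def)

lemma openin_canonical_halfspace:
  fixes u :: "'a::real_vector \<Rightarrow> real"
  assumes "finite B" "span B = (UNIV :: 'a set)" "linear u"
  shows "openin canonical_topology {x. u x < 0}"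
proof -
  obtain C :: "'a set" where C: "finite C" "independent C" "span C = UNIV"
    using finite_basis_exists assms by blast
  have "openin (coordinate_topology C) {x \<in> topspace (coordinate_topology C). u x \<in> {..<0}}"
    by (intro openin_continuous_map_preimage[OF continuous_map_linear_coordinate_topology])
       (use C assms in auto)
  then show ?thesis
    using canonical_topology_eq[OF C] by simp
qed

text \<open>Takes the place of arguments with small balls: in the coordinates of a basis the ray is
  affine in \<open>t\<close>, hence continuous.\<close>

lemma eventually_in_open_along_ray:
  fixes x v :: "'a::real_vector"
  assumes "finite B" "span B = (UNIV :: 'a set)" "openin canonical_topology S" "x \<in> S"
  shows "\<forall>\<^sub>F t in at_right 0. x + t *\<^sub>R v \<in> S"
proof -
  obtain C :: "'a set" where C: "finite C" "independent C" "span C = UNIV"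
    using finite_basis_exists assms by blast
  have "representation C (x + t *\<^sub>R v) b = representation C x b + t * representation C v b" for t b
    using C by (simp add: real_vector.representation_add real_vector.representation_scale)
  then have "continuous_map euclideanreal (coordinate_topology C) (\<lambda>t. x + t *\<^sub>R v)"
    by (intro continuous_map_into_coordinate_topology) (auto intro!: continuous_intros)
  then have "openin euclideanreal {t \<in> topspace euclideanreal. x + t *\<^sub>R v \<in> S}"
    by (rule openin_continuous_map_preimage) (use assms(3) canonical_topology_eq[OF C] in simp)
  then have "open {t. x + t *\<^sub>R v \<in> S}"
    by simp
  then have "\<forall>\<^sub>F t in nhds 0. t \<in> {t. x + t *\<^sub>R v \<in> S}"
    by (rule eventually_nhds_in_open) (use assms(4) in simp)
  then show ?thesis
    by (simp add: eventually_at_filter eventually_mono)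
qed

text \<open>Meant for an inequality \<open>u\<close> on a ray, with \<open>a\<close> its value at
  the start and \<open>b\<close> its slope: a positive value persists for a short time, and a zero
  value leaves the decision to the slope.\<close>

lemma eventually_nonneg_along_ray:
  fixes a b :: real
  assumes "a \<ge> 0" "a = 0 \<Longrightarrow> b \<ge> 0"
  shows "\<forall>\<^sub>F t in at_right 0. 0 \<le> a + t * b"
proof (cases "a = 0")
  case True
  then show ?thesis
    using assms eventually_at_right_less[of "0::real"] by (auto elim: eventually_mono)
next
  case False
  have "((\<lambda>t. a + t * b) \<longlongrightarrow> a + 0 * b) (at_right 0)"
    by (intro tendsto_intros)
  then have "\<forall>\<^sub>F t in at_right 0. 0 < a + t * b"
    by (rule order_tendstoD) (use False assms in auto)
  then show ?thesis
    by (rule eventually_mono) simp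
qed

lemma exists_right_of_zero:
  assumes "\<forall>\<^sub>F t in at_right (0::real). P t"
  obtains t where "t > 0" "P t"
  using eventually_happens'[OF trivial_limit_at_right_real
      eventually_conj[OF assms eventually_at_right_less[of 0]]] by blast

lemma linear_at_segment:
  fixes u :: "'a::real_vector \<Rightarrow> real"
  assumes "linear u"
  shows "u (x + t *\<^sub>R v) = u x + t * u v"
  using assms by (simp add: linear_add linear_cmul)

text \<open>A spanning cone lies in no hyperplane, so for each new functional \<open>w\<close> it
  has a point \<open>h\<close> with \<open>w h \<noteq> 0\<close>. Adding a small multiple of
  \<open>h\<close> to the point found so far works, since each functional forbids at most one
  multiple.\<close>

lemma generic_point_of_spanning_cone:
  fixes C :: "'a::real_vector set" and M :: "('a \<Rightarrow> real) set"
  assumes "span C = UNIV" "0 \<in> C" "\<And>x y t. x \<in> C \<Longrightarrow> y \<in> C \<Longrightarrow> t \<ge> 0 \<Longrightarrow> x + t *\<^sub>R y \<in> C"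
    and "finite M" "\<And>w. w \<in> M \<Longrightarrow> linear w" "\<And>w. w \<in> M \<Longrightarrow> \<exists>v. w v \<noteq> 0"
  obtains g where "g \<in> C" "\<And>w. w \<in> M \<Longrightarrow> w g \<noteq> 0"
proof -
  have "\<exists>g\<in>C. \<forall>w\<in>M. w g \<noteq> 0"
    using assms(4-6)
  proof (induction M)
    case empty
    then show ?case using assms(2) by auto
  next
    case (insert w M)
    then obtain g where g: "g \<in> C" "\<forall>w\<in>M. w g \<noteq> 0"
      by auto
    obtain h where h: "h \<in> C" "w h \<noteq> 0"
    proof -
      have lin: "linear w" and "\<exists>v. w v \<noteq> 0"
        using insert.prems by auto
      then obtain v where "w v \<noteq> 0" by blast
      then show ?thesis
        using that linear_eq_0_on_span[OF lin, of C v] assms(1) by auto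
    qed
    \<comment> \<open>For a functional that is nonzero at \<open>h\<close> this is its unique zero
      along the line. If it vanishes at \<open>h\<close>, division by zero gives 0, which lies
      outside the interval.\<close>
    let ?bad = "(\<lambda>w. - (w g / w h)) ` insert w M"
    have "infinite ({0<..<1} - ?bad)"
      by (intro Diff_infinite_finite infinite_Ioo) (use insert.hyps in auto)
    then obtain t where t: "t \<in> {0<..<1} - ?bad"
      using infinite_imp_nonempty by blast
    have "w' (g + t *\<^sub>R h) \<noteq> 0" if "w' \<in> insert w M" for w'
    proof
      assume "w' (g + t *\<^sub>R h) = 0"
      then have *: "w' g + t * w' h = 0"
        using linear_at_segment insert.prems(1)[OF that] by metis
      then have "w' h \<noteq> 0"
        using that g(2) h(2) by auto
      then have "t = - (w' g / w' h)"
        using * by (simp add: field_simps)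
      then show False
        using t that by blast
    qed
    moreover have "g + t *\<^sub>R h \<in> C"
      using assms(3)[of g h t] g h t by auto
    ultimately show ?case by blast
  qed
  then show thesis using that by blast
qed

section \<open>Cones of a fixed semifan\<close>

locale finite_dim_semifan =
  fixes B W :: "'a::real_vector set" and \<Sigma> :: "'a set set"
  assumes finite_spanning: "finite B" "span B = UNIV"
    and semifan: "semifan W \<Sigma>"
begin

text \<open>One system of inequalities is fixed per cone, so that later arguments can speak of those
  active at a point. It may be redundant.\<close>

definition ineqs :: "'a set \<Rightarrow> ('a \<Rightarrow> real) set" where
  "ineqs \<sigma> = (SOME U. finite U \<and> (\<forall>u\<in>U. linear u) \<and> \<sigma> = {x. \<forall>u\<in>U. u x \<ge> 0})"

lemma finite_semifan: "finite \<Sigma>"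
  and face_in_semifan: "\<sigma> \<in> \<Sigma> \<Longrightarrow> \<tau> \<preceq>\<^sub>f \<sigma> \<Longrightarrow> \<tau> \<in> \<Sigma>"
  and inter_face: "\<sigma> \<in> \<Sigma> \<Longrightarrow> \<tau> \<in> \<Sigma> \<Longrightarrow> \<sigma> \<inter> \<tau> \<preceq>\<^sub>f \<sigma>"
  using semifan unfolding semifan_def by auto

lemma
  assumes "\<sigma> \<in> \<Sigma>"
  shows finite_ineqs: "finite (ineqs \<sigma>)"
    and linear_ineqs: "\<And>u. u \<in> ineqs \<sigma> \<Longrightarrow> linear u"
    and mem_iff_ineqs: "\<And>x. x \<in> \<sigma> \<longleftrightarrow> (\<forall>u\<in>ineqs \<sigma>. u x \<ge> 0)"
proof -
  have "polycone W \<sigma>"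
    using assms semifan unfolding semifan_def by blast
  from someI_ex[OF polycone_functionals[OF this]] 
  have *: "finite (ineqs \<sigma>) \<and> (\<forall>u\<in>ineqs \<sigma>. linear u) \<and> \<sigma> = {x. \<forall>u\<in>ineqs \<sigma>. u x \<ge> 0}"
    unfolding ineqs_def .
  show "finite (ineqs \<sigma>)" "\<And>u. u \<in> ineqs \<sigma> \<Longrightarrow> linear u"
    using * by auto
  have eq: "\<sigma> = {x. \<forall>u\<in>ineqs \<sigma>. u x \<ge> 0}"
    by (rule conjunct2[OF conjunct2[OF *]])
  show "x \<in> \<sigma> \<longleftrightarrow> (\<forall>u\<in>ineqs \<sigma>. u x \<ge> 0)" for x
    using arg_cong[OF eq, of "\<lambda>S. x \<in> S"] unfolding mem_Collect_eq .
qed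

lemma zero_mem: "\<sigma> \<in> \<Sigma> \<Longrightarrow> 0 \<in> \<sigma>"
  unfolding mem_iff_ineqs by (rule ballI) (simp add: linear_0[OF linear_ineqs])

lemma ineqs_nonneg: "\<sigma> \<in> \<Sigma> \<Longrightarrow> u \<in> ineqs \<sigma> \<Longrightarrow> x \<in> \<sigma> \<Longrightarrow> 0 \<le> u x"
  by (rule bspec[OF iffD1[OF mem_iff_ineqs]])

lemma add_scale_mem:
  assumes "\<sigma> \<in> \<Sigma>" "x \<in> \<sigma>" "y \<in> \<sigma>" "t \<ge> 0"
  shows "x + t *\<^sub>R y \<in> \<sigma>"
proof -
  have "0 \<le> u (x + t *\<^sub>R y)" if "u \<in> ineqs \<sigma>" for u
    unfolding linear_at_segment[OF linear_ineqs[OF assms(1) that]]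
    using ineqs_nonneg[OF assms(1) that] assms(2-4) by simp
  then show ?thesis
    unfolding mem_iff_ineqs[OF assms(1)] by (rule ballI)
qed

lemma active_face:
  assumes "\<sigma> \<in> \<Sigma>" "u \<in> ineqs \<sigma>"
  shows "\<sigma> \<inter> {x. u x = 0} \<preceq>\<^sub>f \<sigma>"
  unfolding cone_face_def
  by (intro exI[of _ u] conjI refl ballI linear_ineqs[OF assms] ineqs_nonneg[OF assms])

lemma sum_mem:
  assumes "\<sigma> \<in> \<Sigma>" "\<And>i. i \<in> I \<Longrightarrow> f i \<in> \<sigma>"
  shows "sum f I \<in> \<sigma>"
  using assms(2)
proof (induction I rule: infinite_finite_induct)
  case (insert i I)
  then show ?case
    using add_scale_mem[OF assms(1), of "f i" "sum f I" 1] by auto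
qed (use zero_mem assms(1) in auto)

text \<open>Inequalities inactive at \<open>p\<close> stay positive for a short time, so only the
  active ones restrict the direction; finiteness of the system gives a common time.\<close>

lemma eventually_in_cone_along_ray:
  assumes "\<sigma> \<in> \<Sigma>" "p \<in> \<sigma>" "\<And>u. u \<in> ineqs \<sigma> \<Longrightarrow> u p = 0 \<Longrightarrow> u d \<ge> 0"
  shows "\<forall>\<^sub>F t in at_right 0. p + t *\<^sub>R d \<in> \<sigma>"
proof -
  have "\<forall>\<^sub>F t in at_right 0. 0 \<le> u (p + t *\<^sub>R d)" if "u \<in> ineqs \<sigma>" for u
    unfolding linear_at_segment[OF linear_ineqs[OF assms(1) that]]
    by (rule eventually_nonneg_along_ray) (use ineqs_nonneg[OF assms(1) that assms(2)] assms(3) that in auto)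
  then show ?thesis
    unfolding mem_iff_ineqs[OF assms(1)]
    by (intro eventually_ball_finite finite_ineqs assms(1)) auto
qed

lemma closedin_support: "closedin canonical_topology (\<Union>\<Sigma>)"
proof (rule closedin_Union[OF finite_semifan])
  fix \<sigma> assume \<sigma>: "\<sigma> \<in> \<Sigma>"
  have "- \<sigma> = (\<Union>u\<in>ineqs \<sigma>. {x. u x < 0})"
    by (auto simp: mem_iff_ineqs[OF \<sigma>] simp flip: not_le)
  moreover have "openin canonical_topology (\<Union>u\<in>ineqs \<sigma>. {x. u x < 0})"
    using openin_canonical_halfspace[OF finite_spanning linear_ineqs[OF \<sigma>]] by blast
  ultimately show "closedin canonical_topology \<sigma>"
    by (simp add: closedin_def Compl_eq_Diff_UNIV)
qed

section \<open>Star neighbourhoods\<close>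

text \<open>A convex open neighbourhood of \<open>x\<close> that meets only the cones containing \<open>x\<close>.\<close>

definition star_nbhd :: "'a \<Rightarrow> 'a set" where
  "star_nbhd x = {z. \<forall>\<sigma>\<in>\<Sigma>. \<forall>u\<in>ineqs \<sigma>. u x < 0 \<longrightarrow> u z < 0}"

lemma mem_star_nbhd_self: "x \<in> star_nbhd x"
  by (simp add: star_nbhd_def)

lemma mem_cone_of_star_nbhd:
  assumes "z \<in> star_nbhd x" "\<sigma> \<in> \<Sigma>" "z \<in> \<sigma>"
  shows "x \<in> \<sigma>"
  using assms mem_iff_ineqs[OF assms(2)] unfolding star_nbhd_def by (force simp: not_less)

lemma openin_star_nbhd: "openin canonical_topology (star_nbhd x)"
proof -
  let ?N = "{u \<in> (\<Union>\<sigma>\<in>\<Sigma>. ineqs \<sigma>). u x < 0}"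
  have "openin canonical_topology ((\<Inter>u\<in>?N. {z. u z < 0}) \<inter> topspace canonical_topology)"
  proof (rule openin_INT)
    show "finite ?N"
      using finite_semifan finite_ineqs by auto
    show "openin canonical_topology {z. u z < 0}" if "u \<in> ?N" for u
      using that linear_ineqs openin_canonical_halfspace[OF finite_spanning] by blast
  qed
  moreover have "star_nbhd x = (\<Inter>u\<in>?N. {z. u z < 0})"
    by (auto simp: star_nbhd_def)
  ultimately show ?thesis by simp
qed

lemma star_nbhd_segment:
  assumes "y \<in> star_nbhd x" "z \<in> star_nbhd x" "0 \<le> s" "s \<le> 1"
  shows "z + s *\<^sub>R (y - z) \<in> star_nbhd x"
  unfolding star_nbhd_def
proof (intro CollectI ballI impI)
  fix \<sigma> u assume *: "\<sigma> \<in> \<Sigma>" "u \<in> ineqs \<sigma>" "u x < 0"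
  then have "u y < 0" "u z < 0" and lin: "linear u"
    using assms linear_ineqs by (auto simp: star_nbhd_def)
  moreover have "u (z + s *\<^sub>R (y - z)) = (1 - s) * u z + s * u y"
    by (simp only: linear_at_segment[OF lin] linear_diff[OF lin]) (simp add: algebra_simps)
  ultimately show "u (z + s *\<^sub>R (y - z)) < 0"
    using assms(3,4) convex_bound_lt[of "u z" 0 "u y" "1 - s" s] by simp
qed

section \<open>Faces and hyperplanes by dimension\<close>

text \<open>A face of full dimension spans the same space as the cone, so the functional cutting it
  out vanishes on the whole cone.\<close>

lemma face_eq_if_dim_le:
  fixes \<sigma> \<tau> :: "'a set"
  assumes "\<tau> \<preceq>\<^sub>f \<sigma>" "dim \<sigma> \<le> dim \<tau>"
  shows "\<tau> = \<sigma>"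
proof -
  obtain u :: "'a \<Rightarrow> real" where u: "linear u" "\<tau> = \<sigma> \<inter> {x. u x = 0}"
    using assms(1) unfolding cone_face_def by blast
  then have "span \<tau> = span \<sigma>"
    using dim_eq_imp_span_eq[OF finite_spanning, of \<tau> \<sigma>] assms(2) by blast
  then have "u x = 0" if "x \<in> \<sigma>" for x
    using linear_eq_0_on_span[OF u(1), of \<tau> x] u(2) that real_vector.span_base by blast
  then show ?thesis using u(2) by blast
qed

lemma span_eq_UNIV_iff_dim:
  fixes S :: "'a set"
  shows "span S = UNIV \<longleftrightarrow> dim S = dim (UNIV :: 'a set)"
proof
  show "dim S = dim (UNIV :: 'a set)" if "span S = UNIV"
    using dim_span[of S] that by metis
  show "span S = UNIV" if "dim S = dim (UNIV :: 'a set)"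
    using dim_eq_imp_span_eq[OF finite_spanning, of S UNIV] that by simp
qed

lemma cone_dim_eq_dim: "cone_dim \<sigma> = dim \<sigma>" for \<sigma> :: "'a set"
  unfolding cone_dim_def by simp

text \<open>\<open>S\<close> and \<open>a\<close> together span the space, and
  \<open>w - (w a / u a) u\<close> vanishes on both.\<close>

lemma proportional_if_vanish_on_hyperplane:
  fixes u w :: "'a \<Rightarrow> real"
  assumes "linear u" "linear w" "dim (UNIV :: 'a set) \<le> dim S + 1"
    and "\<And>x. x \<in> S \<Longrightarrow> u x = 0" "\<And>x. x \<in> S \<Longrightarrow> w x = 0" "u a \<noteq> 0"
  shows "w v = w a / u a * u v"
proof -
  have "a \<notin> span S"
    using linear_eq_0_on_span[OF assms(1), of S a] assms(4,6) by blast
  then have "dim (insert a S) = dim S + 1"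
    using dim_insert_real[OF finite_spanning, of a S] by simp
  then have "span (insert a S) = UNIV"
    using dim_eq_imp_span_eq[OF finite_spanning, of "insert a S" UNIV] assms(3) by simp
  moreover have "linear (\<lambda>v. w v - w a / u a * u v)"
    by (rule linearI)
       (simp_all add: linear_add[OF assms(1)] linear_add[OF assms(2)]
          linear_cmul[OF assms(1)] linear_cmul[OF assms(2)] algebra_simps add_divide_distrib)
  moreover have "w x - w a / u a * u x = 0" if "x \<in> insert a S" for x
  proof (cases "x = a")
    case False
    then have "x \<in> S" using that by simp
    then show ?thesis by (simp only: assms(4)[of x] assms(5)[of x])
  qed (use assms(6) in simp)
  ultimately have "w v - w a / u a * u v = 0"
    using linear_eq_0_on_span[of "\<lambda>v. w v - w a / u a * u v" "insert a S" v] by blast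
  then show ?thesis by simp
qed

section \<open>Both families avoid the interior\<close>

text \<open>\<open>g\<close> lies off every proper face of \<open>\<sigma>\<close>, and so does
  \<open>y + t *\<^sub>R g\<close>. If that point lies in \<open>\<rho>\<close>, the face
  \<open>\<sigma> \<inter> \<rho>\<close> of \<open>\<sigma>\<close> cannot be proper, so it equals
  \<open>\<sigma>\<close>; it is also a face of \<open>\<rho>\<close>.\<close>

lemma generic_direction:
  assumes "\<sigma> \<in> \<Sigma>"
  obtains g where "g \<in> \<sigma>"
    "\<And>y t \<rho>. y \<in> \<sigma> \<Longrightarrow> t > 0 \<Longrightarrow> \<rho> \<in> \<Sigma> \<Longrightarrow> y + t *\<^sub>R g \<in> \<rho> \<Longrightarrow> \<sigma> \<preceq>\<^sub>f \<rho>"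
proof -
  let ?P = "{F. F \<preceq>\<^sub>f \<sigma> \<and> F \<noteq> \<sigma>}"
  have fin: "finite ?P"
    by (rule finite_subset[OF _ finite_semifan]) (use face_in_semifan assms in blast)
  have "\<forall>F\<in>?P. \<exists>ux :: ('a \<Rightarrow> real) \<times> 'a. linear (fst ux) \<and> (\<forall>x\<in>\<sigma>. fst ux x \<ge> 0) \<and>
      F = \<sigma> \<inter> {x. fst ux x = 0} \<and> snd ux \<in> \<sigma> \<and> fst ux (snd ux) \<noteq> 0"
  proof
    fix F assume "F \<in> ?P"
    then obtain u :: "'a \<Rightarrow> real" and x where
      "linear u" "\<forall>x\<in>\<sigma>. u x \<ge> 0" "F = \<sigma> \<inter> {x. u x = 0}" "x \<in> \<sigma>" "u x \<noteq> 0"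
      unfolding cone_face_def by blast
    then show "\<exists>ux :: ('a \<Rightarrow> real) \<times> 'a. linear (fst ux) \<and> (\<forall>x\<in>\<sigma>. fst ux x \<ge> 0) \<and>
      F = \<sigma> \<inter> {x. fst ux x = 0} \<and> snd ux \<in> \<sigma> \<and> fst ux (snd ux) \<noteq> 0"
      by (intro exI[of _ "(u, x)"]) simp
  qed
  from bchoice[OF this] obtain ux :: "'a set \<Rightarrow> ('a \<Rightarrow> real) \<times> 'a" where
    ux: "\<forall>F\<in>?P. linear (fst (ux F)) \<and> (\<forall>x\<in>\<sigma>. fst (ux F) x \<ge> 0) \<and>
      F = \<sigma> \<inter> {x. fst (ux F) x = 0} \<and> snd (ux F) \<in> \<sigma> \<and> fst (ux F) (snd (ux F)) \<noteq> 0" ..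
  define u where "u F = fst (ux F)" for F
  define x where "x F = snd (ux F)" for F
  have u: "linear (u F)" "\<And>y. y \<in> \<sigma> \<Longrightarrow> u F y \<ge> 0" "F = \<sigma> \<inter> {x. u F x = 0}"
    and x: "x F \<in> \<sigma>" "u F (x F) \<noteq> 0" if "F \<in> ?P" for F
    using bspec[OF ux that] unfolding u_def x_def by blast+
  \<comment> \<open>Each proper face \<open>F\<close> contributes a point where its functional
    \<open>u F\<close> is positive, and no summand makes \<open>u F\<close> negative. If
    \<open>\<sigma>\<close> has no proper face, then \<open>g = 0\<close>, which suffices.\<close>
  define g where "g = sum x ?P"
  have g: "g \<in> \<sigma>"
    unfolding g_def using sum_mem[OF assms] x(1) by blast
  have pos: "u F g > 0" if F: "F \<in> ?P" for F
  proof -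
    have "u F (x F) > 0"
      using u(2)[OF F x(1)[OF F]] x(2)[OF F] by simp
    also have "u F (x F) \<le> (\<Sum>G\<in>?P. u F (x G))"
      by (rule member_le_sum[OF F]) (use u(2)[OF F] x(1) fin in auto)
    also have "\<dots> = u F g"
      unfolding g_def using linear_sum[OF u(1)[OF F]] by metis
    finally show ?thesis .
  qed
  show thesis
  proof (rule that[OF g])
    fix y t \<rho>
    assume y: "y \<in> \<sigma>" and t: "(t::real) > 0" and \<rho>: "\<rho> \<in> \<Sigma>" and mem: "y + t *\<^sub>R g \<in> \<rho>"
    have "\<sigma> \<inter> \<rho> = \<sigma>"
    proof (rule ccontr)
      assume "\<sigma> \<inter> \<rho> \<noteq> \<sigma>"
      then have F: "\<sigma> \<inter> \<rho> \<in> ?P"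
        using inter_face[OF assms \<rho>] by blast
      have "y + t *\<^sub>R g \<in> \<sigma> \<inter> \<rho>"
        using add_scale_mem[OF assms y g] t mem by simp
      then have "u (\<sigma> \<inter> \<rho>) (y + t *\<^sub>R g) = 0"
        using u(3)[OF F] by blast
      then have "u (\<sigma> \<inter> \<rho>) y + t * u (\<sigma> \<inter> \<rho>) g = 0"
        using linear_at_segment[OF u(1)[OF F]] by metis
      moreover have "t * u (\<sigma> \<inter> \<rho>) g > 0"
        using pos[OF F] t by simp
      ultimately show False
        using u(2)[OF F y] by linarith
    qed
    then show "\<sigma> \<preceq>\<^sub>f \<rho>"
      using inter_face[OF \<rho> assms] by (simp add: Int_commute)
  qed
qed

text \<open>Common criterion for both families. At a generic point of \<open>\<sigma>\<close> a step
  that decreases \<open>w\<close> leaves every cone through the point, hence the support.\<close>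

lemma disjoint_interior_if_supported:
  fixes w :: "'a \<Rightarrow> real"
  assumes "\<sigma> \<in> \<Sigma>" "linear w" "w v \<noteq> 0" "\<And>x. x \<in> \<sigma> \<Longrightarrow> w x = 0"
    and "\<And>\<rho> x. \<rho> \<in> \<Sigma> \<Longrightarrow> \<sigma> \<preceq>\<^sub>f \<rho> \<Longrightarrow> x \<in> \<rho> \<Longrightarrow> w x \<ge> 0"
  shows "\<sigma> \<inter> canonical_topology interior_of (\<Union>\<Sigma>) = {}"
proof (intro equals0I, elim IntE)
  let ?I = "canonical_topology interior_of (\<Union>\<Sigma>)"
  fix y assume y: "y \<in> \<sigma>" "y \<in> ?I"
  obtain g where g: "g \<in> \<sigma>"
    "\<And>y t \<rho>. y \<in> \<sigma> \<Longrightarrow> t > 0 \<Longrightarrow> \<rho> \<in> \<Sigma> \<Longrightarrow> y + t *\<^sub>R g \<in> \<rho> \<Longrightarrow> \<sigma> \<preceq>\<^sub>f \<rho>"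
    using generic_direction[OF assms(1)] by metis
  \<comment> \<open>The first small step makes the point generic without leaving the interior; the
    second, along \<open>v'\<close>, lowers \<open>w\<close> below 0.\<close>
  obtain t where t: "t > 0" "y + t *\<^sub>R g \<in> ?I"
    using exists_right_of_zero[OF eventually_in_open_along_ray[OF finite_spanning openin_interior_of y(2)]]
    by metis
  define y' where "y' = y + t *\<^sub>R g"
  define v' where "v' = (- 1 / w v) *\<^sub>R v"
  have v': "w v' = -1"
    unfolding v'_def linear_cmul[OF assms(2)] using assms(3) by simp
  have "y' \<in> \<sigma>"
    unfolding y'_def using add_scale_mem[OF assms(1) y(1) g(1)] t(1) by simp
  have "y' \<in> ?I \<inter> star_nbhd y'"
    using t mem_star_nbhd_self by (simp add: y'_def)
  then obtain r where r: "r > 0" "y' + r *\<^sub>R v' \<in> ?I \<inter> star_nbhd y'"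
    using exists_right_of_zero[OF eventually_in_open_along_ray[OF finite_spanning
          openin_Int[OF openin_interior_of openin_star_nbhd]]]
    by metis
  then obtain \<rho> where \<rho>: "\<rho> \<in> \<Sigma>" "y' + r *\<^sub>R v' \<in> \<rho>"
    using interior_of_subset[of canonical_topology "\<Union>\<Sigma>"] by blast
  then have "y' \<in> \<rho>"
    using mem_cone_of_star_nbhd r(2) by blast
  then have "\<sigma> \<preceq>\<^sub>f \<rho>"
    using g(2)[OF y(1) t(1) \<rho>(1)] by (simp add: y'_def)
  then have "w (y' + r *\<^sub>R v') \<ge> 0"
    using assms(5) \<rho> by blast
  then show False
    using assms(4)[OF \<open>y' \<in> \<sigma>\<close>] v' r(1) by (simp add: linear_at_segment[OF assms(2)])
qed

text \<open>By maximality \<open>\<sigma>\<close> is the only cone having \<open>\<sigma>\<close> as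
  a face, so any nonzero functional vanishing on \<open>\<sigma>\<close> meets the
  criterion.\<close>

lemma deficient_disjoint_interior:
  assumes "\<sigma> \<in> \<DD> \<Sigma>"
  shows "\<sigma> \<inter> canonical_topology interior_of (\<Union>\<Sigma>) = {}"
proof -
  have \<sigma>: "\<sigma> \<in> \<Sigma>" and mx: "\<And>\<rho>. \<rho> \<in> \<Sigma> \<Longrightarrow> \<sigma> \<preceq>\<^sub>f \<rho> \<Longrightarrow> \<rho> = \<sigma>" and "dim \<sigma> \<noteq> dim (UNIV :: 'a set)"
    using assms by (auto simp: deficient_cones_def max_cones_def cones_of_dim_def cone_dim_eq_dim)
  then have "span \<sigma> \<noteq> UNIV"
    by (simp add: span_eq_UNIV_iff_dim)
  then obtain w :: "'a \<Rightarrow> real" and v where w: "linear w" "w v = 1" "\<And>x. x \<in> span \<sigma> \<Longrightarrow> w x = 0"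
    using exists_functional_vanishing_on by metis
  then have vanish: "w x = 0" if "x \<in> \<sigma>" for x
    using that real_vector.span_base by metis
  show ?thesis
  proof (rule disjoint_interior_if_supported[OF \<sigma> w(1) _ vanish])
    show "w v \<noteq> 0" using w(2) by simp
    show "w x \<ge> 0" if "\<rho> \<in> \<Sigma>" "\<sigma> \<preceq>\<^sub>f \<rho>" "x \<in> \<rho>" for \<rho> x
      using mx[OF that(1,2)] that(3) vanish by simp
  qed
qed

text \<open>The functional cutting \<open>\<sigma>\<close> out of its unique full-dimensional cone
  \<open>\<tau>\<close> meets the criterion: a cone having \<open>\<sigma>\<close> as a face is
  \<open>\<tau>\<close>, or has dimension at most that of \<open>\<sigma>\<close> and then equals
  \<open>\<sigma>\<close>.\<close>

lemma free_facet_disjoint_interior: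
  assumes "\<sigma> \<in> \<FF> \<Sigma>"
  shows "\<sigma> \<inter> canonical_topology interior_of (\<Union>\<Sigma>) = {}"
proof -
  have \<sigma>: "\<sigma> \<in> \<Sigma>" "dim \<sigma> + 1 = dim (UNIV :: 'a set)"
    and ex1: "\<exists>!\<tau>. \<tau> \<in> \<Sigma> \<and> dim \<tau> = dim (UNIV :: 'a set) \<and> \<sigma> \<preceq>\<^sub>f \<tau>"
    using assms by (simp_all add: free_facets_def cones_of_dim_def cone_dim_eq_dim conj_assoc)
  obtain \<tau> where \<tau>: "\<tau> \<in> \<Sigma>" "dim \<tau> = dim (UNIV :: 'a set)" "\<sigma> \<preceq>\<^sub>f \<tau>"
    using ex1 by blast
  have unique: "\<rho> = \<tau>" if "\<rho> \<in> \<Sigma>" "dim \<rho> = dim (UNIV :: 'a set)" "\<sigma> \<preceq>\<^sub>f \<rho>" for \<rho>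
    using ex1 \<tau> that by blast
  obtain w :: "'a \<Rightarrow> real" where w: "linear w" "\<And>x. x \<in> \<tau> \<Longrightarrow> w x \<ge> 0" "\<sigma> = \<tau> \<inter> {x. w x = 0}"
    using \<tau>(3) unfolding cone_face_def by blast
  have "\<sigma> \<noteq> \<tau>"
    using \<sigma>(2) \<tau>(2) by auto
  then obtain v where v: "w v \<noteq> 0"
    using w(3) by blast
  show ?thesis
  proof (rule disjoint_interior_if_supported[OF \<sigma>(1) w(1) v])
    fix \<rho> x assume \<rho>: "\<rho> \<in> \<Sigma>" "\<sigma> \<preceq>\<^sub>f \<rho>" "x \<in> \<rho>"
    show "w x \<ge> 0"
    proof (cases "dim \<rho> = dim (UNIV :: 'a set)")
      case True
      then show ?thesis using unique \<rho> w(2) by blast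
    next
      case False
      then have "dim \<rho> \<le> dim \<sigma>"
        using dim_mono_real[OF finite_spanning, of \<rho> UNIV] \<sigma>(2) by simp
      then show ?thesis
        using face_eq_if_dim_le[OF \<rho>(2)] \<rho>(3) w(3) by (metis (mono_tags) IntD2 mem_Collect_eq order_refl)
    qed
  qed (use w(3) in auto)
qed

section \<open>Points outside both families are interior\<close>

text \<open>A cone of largest dimension through \<open>x\<close> is maximal, because any cone having
  it as a face also contains \<open>x\<close>. Not being in \<open>\<DD> \<Sigma>\<close>, it is
  full-dimensional.\<close>

lemma full_dimensional_cone_exists:
  assumes "x \<in> \<Union>\<Sigma>" "x \<notin> \<Union>(\<DD> \<Sigma>)"
  obtains \<rho> where "\<rho> \<in> \<Sigma>" "x \<in> \<rho>" "dim \<rho> = dim (UNIV :: 'a set)"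
proof -
  let ?S = "{\<sigma> \<in> \<Sigma>. x \<in> \<sigma>}"
  have "finite ?S" "?S \<noteq> {}"
    using finite_semifan assms(1) by auto
  then obtain \<rho> where \<rho>: "\<rho> \<in> ?S" "dim \<rho> = Max (dim ` ?S)"
    using obtains_MAX[of ?S dim] by metis
  have le: "dim \<tau> \<le> dim \<rho>" if "\<tau> \<in> ?S" for \<tau>
    unfolding \<rho>(2) by (intro Max_ge) (use \<open>finite ?S\<close> that in auto)
  have "\<tau> = \<rho>" if \<tau>: "\<tau> \<in> \<Sigma>" "\<rho> \<preceq>\<^sub>f \<tau>" for \<tau>
  proof -
    have "x \<in> \<tau>"
      using \<tau>(2) \<rho>(1) unfolding cone_face_def by blast
    then show ?thesis
      using face_eq_if_dim_le[OF \<tau>(2)] le \<tau>(1) by auto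
  qed
  then have "\<rho> \<in> max_cones \<Sigma>"
    using \<rho>(1) by (auto simp: max_cones_def)
  then have "dim \<rho> = dim (UNIV :: 'a set)"
    using assms(2) \<rho>(1) by (auto simp: deficient_cones_def cones_of_dim_def cone_dim_eq_dim)
  then show thesis
    using that \<rho>(1) by blast
qed

text \<open>If the segment from \<open>z\<close> met \<open>\<sigma>\<close> before reaching
  \<open>y\<close>, then \<open>z\<close> would lie in \<open>span (insert y \<sigma>)\<close>. For
  codimension at least two this span is proper, so finitely many hyperplanes have to be
  avoided.\<close>

lemma generic_point_near:
  assumes "\<rho> \<in> \<Sigma>" "x \<in> \<rho>" "dim \<rho> = dim (UNIV :: 'a set)"
  obtains z where "z \<in> \<rho>" "z \<in> star_nbhd x"
    "\<And>\<sigma>. \<sigma> \<in> \<Sigma> \<Longrightarrow> dim \<sigma> + 1 < dim (UNIV :: 'a set) \<Longrightarrow> z \<notin> span (insert y \<sigma>)"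
proof -
  let ?L = "{\<sigma> \<in> \<Sigma>. dim \<sigma> + 1 < dim (UNIV :: 'a set)}"
  have "\<exists>w :: 'a \<Rightarrow> real. linear w \<and> (\<exists>v. w v \<noteq> 0) \<and> (\<forall>x\<in>span (insert y \<sigma>). w x = 0)"
    if "\<sigma> \<in> ?L" for \<sigma>
  proof -
    have "dim (insert y \<sigma>) \<le> dim \<sigma> + 1"
      using dim_insert_real[OF finite_spanning, of y \<sigma>] by simp
    then have "span (insert y \<sigma>) \<noteq> UNIV"
      using that by (auto simp: span_eq_UNIV_iff_dim)
    then obtain w :: "'a \<Rightarrow> real" and v where "linear w" "w v = 1" "\<And>x. x \<in> span (insert y \<sigma>) \<Longrightarrow> w x = 0"
      using exists_functional_vanishing_on[of "insert y \<sigma>"] by blast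
    then show ?thesis
      by (intro exI[of _ w] conjI exI[of _ v]) auto
  qed
  then have "\<forall>\<sigma>\<in>?L. \<exists>w :: 'a \<Rightarrow> real. linear w \<and> (\<exists>v. w v \<noteq> 0) \<and> (\<forall>x\<in>span (insert y \<sigma>). w x = 0)"
    by blast
  from bchoice[OF this] obtain w :: "'a set \<Rightarrow> 'a \<Rightarrow> real" where
    w: "\<forall>\<sigma>\<in>?L. linear (w \<sigma>) \<and> (\<exists>v. w \<sigma> v \<noteq> 0) \<and> (\<forall>x\<in>span (insert y \<sigma>). w \<sigma> x = 0)" ..
  have fin: "finite (w ` ?L)"
    using finite_semifan by simp
  obtain g where g: "g \<in> \<rho>" "\<And>u. u \<in> w ` ?L \<Longrightarrow> u g \<noteq> 0"
  proof (rule generic_point_of_spanning_cone[of \<rho> "w ` ?L"])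
    show "span \<rho> = UNIV"
      using assms(3) by (simp add: span_eq_UNIV_iff_dim)
  qed (use zero_mem add_scale_mem assms(1) w fin in auto)
  \<comment> \<open>As a function of \<open>t\<close> the value has the single zero
    \<open>- (u x / u g)\<close>: either 0, which a right-sided limit ignores, or bounded away from
    0.\<close>
  have nz: "\<forall>\<^sub>F t in at_right 0. u (x + t *\<^sub>R g) \<noteq> 0" if "u \<in> w ` ?L" for u
  proof -
    have lin: "linear u" using that w by blast
    have nz: "u g \<noteq> 0" using g(2) that by blast
    have "\<forall>\<^sub>F t in at 0 within {0<..}. t \<noteq> - (u x / u g)"
    proof (cases "u x = 0")
      case True
      then show ?thesis by (simp add: eventually_at_filter)
    next
      case False
      then show ?thesis
        using nz by (intro tendsto_imp_eventually_ne[OF tendsto_ident_at]) auto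
    qed
    then show ?thesis
      by (rule eventually_mono) (use nz in \<open>auto simp: linear_at_segment[OF lin] field_simps\<close>)
  qed
  have all_nz: "\<forall>\<^sub>F t in at_right 0. \<forall>u\<in>w ` ?L. u (x + t *\<^sub>R g) \<noteq> 0"
  proof (rule eventually_ball_finite[OF fin], rule ballI)
    fix u assume "u \<in> w ` ?L"
    then show "\<forall>\<^sub>F t in at_right 0. u (x + t *\<^sub>R g) \<noteq> 0"
      by (rule nz[of u])
  qed
  note * = eventually_conj[OF all_nz
      eventually_in_open_along_ray[OF finite_spanning openin_star_nbhd mem_star_nbhd_self, of x g]]
  obtain t where t: "t > 0"
    "(\<forall>u\<in>w ` ?L. u (x + t *\<^sub>R g) \<noteq> 0) \<and> x + t *\<^sub>R g \<in> star_nbhd x"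
    by (rule exists_right_of_zero[OF *])
  show thesis
  proof (rule that)
    show "x + t *\<^sub>R g \<in> \<rho>"
      using add_scale_mem[OF assms(1,2) g(1)] t(1) by simp
    show "x + t *\<^sub>R g \<in> star_nbhd x"
      using t(2) by (rule conjunct2)
    show "x + t *\<^sub>R g \<notin> span (insert y \<sigma>)" if "\<sigma> \<in> \<Sigma>" "dim \<sigma> + 1 < dim (UNIV :: 'a set)" for \<sigma>
    proof -
      have \<sigma>: "\<sigma> \<in> ?L" using that by simp
      have "w \<sigma> (x + t *\<^sub>R g) \<noteq> 0"
        using bspec[OF conjunct1[OF t(2)] imageI[OF \<sigma>]] .
      then show ?thesis
        using bspec[OF w \<sigma>] by blast
    qed
  qed
qed

text \<open>The parameters in \<open>[0, 1]\<close> whose points lie in full-dimensional cones form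
  a nonempty compact set; \<open>s\<close> is its maximum. It is not 1, since \<open>y\<close> is
  outside the support.\<close>

lemma last_point_in_full_dimensional_cones:
  assumes "\<rho> \<in> \<Sigma>" "dim \<rho> = dim (UNIV :: 'a set)" "z \<in> \<rho>" "y \<notin> \<Union>\<Sigma>"
  obtains s \<rho>' where "0 \<le> s" "s < 1" "\<rho>' \<in> \<Sigma>" "dim \<rho>' = dim (UNIV :: 'a set)" "z + s *\<^sub>R (y - z) \<in> \<rho>'"
    "\<And>\<tau>. \<tau> \<in> \<Sigma> \<Longrightarrow> dim \<tau> = dim (UNIV :: 'a set) \<Longrightarrow> z + s *\<^sub>R (y - z) \<in> \<tau> \<Longrightarrow>
       \<exists>u\<in>ineqs \<tau>. u (z + s *\<^sub>R (y - z)) = 0 \<and> u (y - z) < 0"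
proof -
  let ?N = "{\<sigma> \<in> \<Sigma>. dim \<sigma> = dim (UNIV :: 'a set)}"
  define d where "d = y - z"
  let ?T = "{0..1} \<inter> (\<Union>\<sigma>\<in>?N. {t. z + t *\<^sub>R d \<in> \<sigma>})"
  have "closed {t. z + t *\<^sub>R d \<in> \<sigma>}" if "\<sigma> \<in> ?N" for \<sigma>
  proof -
    have \<sigma>: "\<sigma> \<in> \<Sigma>" using that by blast
    have "{t. z + t *\<^sub>R d \<in> \<sigma>} = (\<Inter>u\<in>ineqs \<sigma>. {t. 0 \<le> u z + t * u d})"
      using mem_iff_ineqs[OF \<sigma>] linear_at_segment[OF linear_ineqs[OF \<sigma>]] by auto
    moreover have "closed {t. 0 \<le> u z + t * u d}" for u :: "'a \<Rightarrow> real"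
      by (intro closed_Collect_le continuous_intros)
    ultimately show ?thesis by auto
  qed
  then have "closed (\<Union>\<sigma>\<in>?N. {t. z + t *\<^sub>R d \<in> \<sigma>})"
    using finite_semifan by (intro closed_UN) auto
  then have "compact ?T"
    by (intro compact_Int_closed) auto
  moreover have "0 \<in> ?T"
    using assms by auto
  ultimately obtain s where s: "s \<in> ?T" "\<And>t. t \<in> ?T \<Longrightarrow> t \<le> s"
    using compact_attains_sup[of ?T] by blast
  then obtain \<rho>' where \<rho>': "\<rho>' \<in> ?N" "z + s *\<^sub>R d \<in> \<rho>'"
    by blast
  have "s \<noteq> 1"
    using \<rho>' assms(4) by (auto simp: d_def)
  then have s1: "s < 1" using s(1) by simp
  show thesis
  proof (rule that[of s \<rho>'])
    fix \<tau> assume \<tau>: "\<tau> \<in> \<Sigma>" "dim \<tau> = dim (UNIV :: 'a set)" "z + s *\<^sub>R (y - z) \<in> \<tau>"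
    show "\<exists>u\<in>ineqs \<tau>. u (z + s *\<^sub>R (y - z)) = 0 \<and> u (y - z) < 0"
    proof (rule ccontr)
      \<comment> \<open>If no active inequality decreases, \<open>\<tau>\<close> contains a further
        piece of the segment, against the maximality of \<open>s\<close>.\<close>
      assume "\<not> ?thesis"
      then have "\<forall>\<^sub>F t in at_right 0. (z + s *\<^sub>R d) + t *\<^sub>R d \<in> \<tau>"
        using \<tau> by (intro eventually_in_cone_along_ray) (auto simp: d_def not_less)
      moreover have "\<forall>\<^sub>F t in at_right 0. t < 1 - s"
        using s1 by (intro eventually_at_rightI[of 0 "1 - s"]) auto
      ultimately have *: "\<forall>\<^sub>F t in at_right 0. (z + s *\<^sub>R d) + t *\<^sub>R d \<in> \<tau> \<and> t < 1 - s"
        by (rule eventually_conj)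
      obtain t where t: "t > 0" "(z + s *\<^sub>R d) + t *\<^sub>R d \<in> \<tau>" "t < 1 - s"
        using exists_right_of_zero[OF *] by blast
      then have "s + t \<in> ?T"
        using \<tau> s(1) by (auto simp: scaleR_left_distrib add.assoc)
      then show False
        using s(2) t(1) by fastforce
    qed
  qed (use s s1 \<rho>' in \<open>auto simp: d_def\<close>)
qed

text \<open>If all cones through \<open>p\<close> have codimension at most one, then all inequalities of \<open>\<rho>\<close> that are
  active at \<open>p\<close> are positive multiples of each other, so \<open>\<rho>\<close> is a halfspace near \<open>p\<close>.\<close>

lemma eventually_in_cone_backwards:
  assumes "\<rho> \<in> \<Sigma>" "dim \<rho> = dim (UNIV :: 'a set)" "p \<in> \<rho>"
    and "u \<in> ineqs \<rho>" "u p = 0" "u d < 0"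
    and codim: "\<And>\<sigma>. \<sigma> \<in> \<Sigma> \<Longrightarrow> p \<in> \<sigma> \<Longrightarrow> dim (UNIV :: 'a set) \<le> dim \<sigma> + 1"
  shows "\<forall>\<^sub>F t in at_right 0. p + t *\<^sub>R (- d) \<in> \<rho>"
proof (rule eventually_in_cone_along_ray[OF assms(1,3)])
  fix v assume v: "v \<in> ineqs \<rho>" "v p = 0"
  have lin: "linear u" "linear v"
    using linear_ineqs[OF assms(1)] assms(4) v(1) by auto
  have nonneg: "u x \<ge> 0" "v x \<ge> 0" if "x \<in> \<rho>" for x
    using that assms(4) v(1) ineqs_nonneg[OF assms(1)] by blast+
  have faces: "\<rho> \<inter> {x. u x = 0} \<preceq>\<^sub>f \<rho>" "\<rho> \<inter> {x. v x = 0} \<preceq>\<^sub>f \<rho>"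
    using active_face[OF assms(1)] assms(4) v(1) by auto
  \<comment> \<open>The common face on which \<open>u\<close> and \<open>v\<close> both vanish
    contains \<open>p\<close>, so \<open>codim\<close> applies to it.\<close>
  then have "\<rho> \<inter> {x. u x = 0} \<inter> (\<rho> \<inter> {x. v x = 0}) \<in> \<Sigma>"
    using face_in_semifan assms(1) inter_face by metis
  then have dim: "dim (UNIV :: 'a set) \<le> dim (\<rho> \<inter> {x. u x = 0} \<inter> (\<rho> \<inter> {x. v x = 0})) + 1"
    using codim assms(3,5) v(2) by auto
  have "span \<rho> = UNIV"
    using assms(2) by (simp add: span_eq_UNIV_iff_dim)
  \<comment> \<open>Both functionals are nonnegative at \<open>a\<close>, which fixes the sign of
    the factor of proportionality.\<close>
  then obtain a where a: "a \<in> \<rho>" "u a \<noteq> 0"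
    using linear_eq_0_on_span[OF lin(1), of \<rho> d] assms(6) by force
  have "v d = v a / u a * u d"
    by (rule proportional_if_vanish_on_hyperplane[OF lin dim]) (use a in auto)
  then have "v d \<le> 0"
    using nonneg[OF a(1)] assms(6) by (simp add: mult_nonneg_nonpos divide_nonpos_nonneg)
  then show "v (- d) \<ge> 0"
    unfolding linear_neg[OF lin(2)] by simp
qed

lemma star_nbhd_subset_support:
  assumes "x \<in> \<Union>\<Sigma>" "x \<notin> \<Union>(\<DD> \<Sigma>)" "x \<notin> \<Union>(\<FF> \<Sigma>)"
  shows "star_nbhd x \<subseteq> \<Union>\<Sigma>"
proof (rule ccontr)
  let ?n = "dim (UNIV :: 'a set)"
  assume "\<not> ?thesis"
  then obtain y where y: "y \<in> star_nbhd x" "y \<notin> \<Union>\<Sigma>"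
    by blast
  obtain \<rho>0 where \<rho>0: "\<rho>0 \<in> \<Sigma>" "x \<in> \<rho>0" "dim \<rho>0 = ?n"
    using full_dimensional_cone_exists assms by blast
  obtain z where z: "z \<in> \<rho>0" "z \<in> star_nbhd x"
    "\<And>\<sigma>. \<sigma> \<in> \<Sigma> \<Longrightarrow> dim \<sigma> + 1 < ?n \<Longrightarrow> z \<notin> span (insert y \<sigma>)"
    using generic_point_near[OF \<rho>0, of y] by metis
  obtain s \<rho> where s: "0 \<le> s" "s < 1" and \<rho>: "\<rho> \<in> \<Sigma>" "dim \<rho> = ?n" "z + s *\<^sub>R (y - z) \<in> \<rho>"
    and active: "\<And>\<tau>. \<tau> \<in> \<Sigma> \<Longrightarrow> dim \<tau> = ?n \<Longrightarrow> z + s *\<^sub>R (y - z) \<in> \<tau> \<Longrightarrow>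
       \<exists>u\<in>ineqs \<tau>. u (z + s *\<^sub>R (y - z)) = 0 \<and> u (y - z) < 0"
    using last_point_in_full_dimensional_cones[OF \<rho>0(1,3) z(1) y(2)] by metis
  define d where "d = y - z"
  define p where "p = z + s *\<^sub>R d"
  note \<rho> = \<rho>[folded d_def, folded p_def]
  note active = active[folded d_def, folded p_def]
  have p_star: "p \<in> star_nbhd x"
    unfolding p_def d_def using star_nbhd_segment y(1) z(2) s by simp
  \<comment> \<open>Since \<open>s < 1\<close>, the equation for \<open>p\<close> can be solved for
    \<open>z\<close>, placing \<open>z\<close> in the span of \<open>y\<close> and
    \<open>\<sigma>\<close>, which the choice of \<open>z\<close> excludes in codimension at least
    two.\<close>
  have codim: "?n \<le> dim \<sigma> + 1" if \<sigma>: "\<sigma> \<in> \<Sigma>" "p \<in> \<sigma>" for \<sigma>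
  proof (rule ccontr)
    assume "\<not> ?thesis"
    then have "z \<notin> span (insert y \<sigma>)"
      using z(3) \<sigma>(1) by simp
    moreover have "z = (1 / (1 - s)) *\<^sub>R (p - s *\<^sub>R y)"
    proof -
      have "p - s *\<^sub>R y = (1 - s) *\<^sub>R z"
        by (simp add: p_def d_def algebra_simps)
      then show ?thesis using s(2) by simp
    qed
    moreover have "(1 / (1 - s)) *\<^sub>R (p - s *\<^sub>R y) \<in> span (insert y \<sigma>)"
      using \<sigma>(2) by (intro real_vector.span_scale real_vector.span_diff real_vector.span_base) auto
    ultimately show False by simp
  qed
  obtain u where u: "u \<in> ineqs \<rho>" "u p = 0" "u d < 0"
    using active[OF \<rho>] by blast
  have u_lin: "linear u"
    by (rule linear_ineqs[OF \<rho>(1) u(1)])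
  define \<sigma> where "\<sigma> = \<rho> \<inter> {x. u x = 0}"
  have \<sigma>_face: "\<sigma> \<preceq>\<^sub>f \<rho>"
    unfolding \<sigma>_def by (rule active_face[OF \<rho>(1) u(1)])
  have \<sigma>: "\<sigma> \<in> \<Sigma>" "p \<in> \<sigma>"
    using face_in_semifan \<sigma>_face \<rho> u(2) by (auto simp: \<sigma>_def)
  \<comment> \<open>\<open>u\<close> vanishes on \<open>\<sigma>\<close> but not at
    \<open>d\<close>, so with \<open>codim\<close> the codimension of \<open>\<sigma>\<close> is
    exactly one.\<close>
  have "span \<sigma> \<noteq> UNIV"
    using linear_eq_0_on_span[OF u_lin, of \<sigma> d] u(3) by (auto simp: \<sigma>_def)
  then have "dim \<sigma> \<noteq> ?n"
    by (simp add: span_eq_UNIV_iff_dim)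
  then have "dim \<sigma> + 1 = ?n"
    using codim[OF \<sigma>] dim_mono_real[OF finite_spanning, of \<sigma> UNIV] by simp
  then have "\<sigma> \<in> cones_of_dim \<Sigma> (int ?n - 1)"
    using \<sigma>(1) by (auto simp: cones_of_dim_def cone_dim_eq_dim)
  \<comment> \<open>\<open>p\<close> is in the star neighbourhood of \<open>x\<close>, so
    \<open>x\<close> lies in \<open>\<sigma>\<close>.\<close>
  moreover have "\<sigma> \<notin> \<FF> \<Sigma>"
    using mem_cone_of_star_nbhd[OF p_star \<sigma>] assms(3) by blast
  ultimately have "\<not> (\<exists>!\<tau>. \<tau> \<in> cones_of_dim \<Sigma> (int ?n) \<and> \<sigma> \<preceq>\<^sub>f \<tau>)"
    by (simp add: free_facets_def)
  moreover have "\<rho> \<in> cones_of_dim \<Sigma> (int ?n)"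
    using \<rho>(1,2) by (simp add: cones_of_dim_def cone_dim_eq_dim)
  ultimately obtain \<rho>' where "\<rho>' \<in> cones_of_dim \<Sigma> (int ?n)" and \<rho>'_face: "\<sigma> \<preceq>\<^sub>f \<rho>'" "\<rho>' \<noteq> \<rho>"
    using \<sigma>_face by blast
  then have \<rho>': "\<rho>' \<in> \<Sigma>" "dim \<rho>' = ?n" "\<sigma> \<preceq>\<^sub>f \<rho>'" "\<rho>' \<noteq> \<rho>"
    by (simp_all add: cones_of_dim_def cone_dim_eq_dim)
  have \<sigma>_sub: "\<sigma> \<subseteq> \<rho> \<inter> \<rho>'"
    using \<rho>'(3) unfolding \<sigma>_def cone_face_def by blast
  then have p': "p \<in> \<rho>'"
    using \<sigma>(2) by blast
  obtain u' where u': "u' \<in> ineqs \<rho>'" "u' p = 0" "u' d < 0"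
    using active[OF \<rho>'(1,2) p'] by blast
  have "\<forall>\<^sub>F t in at_right 0. p + t *\<^sub>R (- d) \<in> \<rho>"
    by (rule eventually_in_cone_backwards[OF \<rho> u], rule codim)
  moreover have "\<forall>\<^sub>F t in at_right 0. p + t *\<^sub>R (- d) \<in> \<rho>'"
    by (rule eventually_in_cone_backwards[OF \<rho>'(1,2) p' u'], rule codim)
  ultimately have *: "\<forall>\<^sub>F t in at_right 0. p + t *\<^sub>R (- d) \<in> \<rho> \<and> p + t *\<^sub>R (- d) \<in> \<rho>'"
    by (rule eventually_conj)
  obtain t where t: "t > 0" "p + t *\<^sub>R (- d) \<in> \<rho> \<inter> \<rho>'"
    using exists_right_of_zero[OF *] by blast
  \<comment> \<open>\<open>w\<close> and \<open>u\<close> both vanish on \<open>\<sigma>\<close>,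
    and \<open>w\<close> is not zero, so \<open>u\<close> is a multiple of \<open>w\<close>. Hence
    \<open>u\<close> vanishes at the common point \<open>p + t *\<^sub>R (- d)\<close>, although its
    value there is \<open>- t * u d > 0\<close>.\<close>
  obtain w :: "'a \<Rightarrow> real" where w: "linear w" "\<rho> \<inter> \<rho>' = \<rho> \<inter> {x. w x = 0}"
    using inter_face[OF \<rho>(1) \<rho>'(1)] unfolding cone_face_def by blast
  \<comment> \<open>Otherwise \<open>\<rho>\<close> would be a face of \<open>\<rho>'\<close> of the
    same dimension, hence equal to it.\<close>
  have "\<rho> \<inter> \<rho>' \<noteq> \<rho>"
    using inter_face[OF \<rho>'(1) \<rho>(1)] face_eq_if_dim_le[of \<rho> \<rho>'] \<rho>(2) \<rho>'(2,4)
    by (metis Int_commute order_refl)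
  then obtain a where a: "w a \<noteq> 0"
    using w(2) by blast
  have "u (p + t *\<^sub>R (- d)) = u a / w a * w (p + t *\<^sub>R (- d))"
    by (rule proportional_if_vanish_on_hyperplane[OF w(1) u_lin codim[OF \<sigma>]])
       (use a \<sigma>_sub w(2) \<sigma>_def in blast)+
  also have "w (p + t *\<^sub>R (- d)) = 0"
    using t(2) w(2) by blast
  finally have "u (p + t *\<^sub>R (- d)) = 0" by simp
  then have "t * u d = 0"
    unfolding linear_at_segment[OF u_lin] linear_neg[OF u_lin] using u(2) by simp
  then show False
    using t(1) u(3) by simp
qed

section \<open>The frontier formula\<close>

theorem frontier_of_support:
  "canonical_topology frontier_of (\<Union>\<Sigma>) = \<Union>(\<DD> \<Sigma>) \<union> \<Union>(\<FF> \<Sigma>)"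
proof -
  let ?I = "canonical_topology interior_of (\<Union>\<Sigma>)"
  have "canonical_topology frontier_of (\<Union>\<Sigma>) = \<Union>\<Sigma> - ?I"
    unfolding frontier_of_def closure_of_closedin[OF closedin_support] ..
  moreover have "\<DD> \<Sigma> \<subseteq> \<Sigma>"
    unfolding deficient_cones_def max_cones_def by blast
  moreover have "\<FF> \<Sigma> \<subseteq> \<Sigma>"
    unfolding free_facets_def cones_of_dim_def by blast
  moreover have "(\<Union>(\<DD> \<Sigma>) \<union> \<Union>(\<FF> \<Sigma>)) \<inter> ?I = {}"
    using deficient_disjoint_interior free_facet_disjoint_interior by blast
  moreover have "x \<in> ?I" if "x \<in> \<Union>\<Sigma>" "x \<notin> \<Union>(\<DD> \<Sigma>) \<union> \<Union>(\<FF> \<Sigma>)" for x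
    using interior_of_maximal[OF star_nbhd_subset_support openin_star_nbhd, of x] that
      mem_star_nbhd_self[of x] by blast
  ultimately show ?thesis by blast
qed

end

theorem mainTheorem3:
  fixes K :: "real set" and W :: "'a::real_vector set" and \<Sigma> :: "'a set set"
  assumes "\<exists>B::'a set. finite B \<and> span B = UNIV"
    and "subfield K (ring_of_type_algebra :: real ring)"
    and "K_structure K W"
    and "semifan W \<Sigma>"
  shows "canonical_topology frontier_of (\<Union>\<Sigma>) = \<Union>(\<DD> \<Sigma>) \<union> \<Union>(\<FF> \<Sigma>)"
proof -
  obtain B :: "'a set" where "finite B" "span B = UNIV"
    using assms(1) by blast
  then interpret finite_dim_semifan B W \<Sigma>
    using assms(4) by unfold_locales
  show ?thesis
    by (rule frontier_of_support)
qed

end
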